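(* Let $s\ge3$ and let $L(x_1,\dots,x_s)=c_1x_1+\dots+c_sx_s$ be a translation-invariant linear form (that is, $c_i\in\mathbb{Z}\setminus\{0\}$ and $c_1+\dots+c_s=0$). Let $m\ge 2$ and $r\ge1$ be integers. Assume that $L$ is primitive over $\mathbb{Z}_m=\mathbb{Z}/m\mathbb{Z}$ and that $L$ has the same coefficient partition over $\mathbb{Z}_m$ as over $\mathbb{Z}$ (in particular $L$ is also primitive over $\mathbb{Z}$). Let $A\subseteq\mathbb{Z}_m^r$ be a nonempty $L$-seed. Then \[ r_L(N)\ \ge\ N^{\frac1r\log_m|A|}\,\exp\left(-O_{A,L}\left(\sqrt{\log N\log\log N}\right)\right), \] i.e. there is a constant $C>0$ depending only on $A$ (as a subset of $\mathbb{Z}_m^r$) and $L$ such that $r_L(N)\ge N^{\frac1r\log_m|A|}\exp(-C\sqrt{\log N\log\log N})$ for all integers $N\ge3$.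
   Context: Triviality. Let $G$ be an abelian group; the coefficients $c_i$ are interpreted as endomorphisms of $G$. For a solution $(x_1,\dots,x_s)\in G^s$ to $L=0$, let $\mathcal T$ be the partition of $[s]=\{1,\dots,s\}$ in which $i,j$ lie in the same block if and only if $x_i=x_j$. The solution is trivial if for all $T\in\mathcal T$, $\sum_{i\in T}c_i=0$ as an endomorphism of $G$ (for $G=\mathbb{Z}$: equal to $0$ in $\mathbb{Z}$; for $G=\mathbb{Z}_m^r$: $\equiv0$ mod $m$), and nontrivial otherwise. A set $A\subseteq G$ is $L$-free if all solutions in $A^s$ to $L=0$ are trivial. Define $r_L(N)=\max\{|A| : A\subseteq\{1,\dots,N\}\subseteq\mathbb{Z} \text{ is } L\text{-free}\}$. Primitivity. For $R=\mathbb{Z}$ or $R=\mathbb{Z}_m$, $L$ is primitive over $R$ if, among the partitions $\mathcal T$ of $[s]$ with $\sum_{i\in T}c_i=0$ in $R$ for all $T\in\mathcal T$, there is a unique finest one (i.e. a unique one minimal under refinement; equivalently, one that refines all the others); this finest partition is the coefficient partition of $L$ over $R$. $L$-seeds. A subset $A$ of a finite abelian group $G$ is an $L$-seed if there are functions $f_1,\dots,f_s:A\to\mathbb{Z}$ such that $\sum_{i=1}^sf_i(x_i)=0$ for all trivial solutions $(x_1,\dots,x_s)\in A^s$ to $L=0$ and $\sum_{i=1}^sf_i(x_i)>0$ for all nontrivial solutions $(x_1,\dots,x_s)\in A^s$ to $L=0$. *)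

theory Defs
  imports
    Complex_Main
    "HOL-Library.Disjoint_Sets"
    "HOL-Number_Theory.Cong"
    "HOL-Algebra.FiniteProduct"
    "HOL-Algebra.Elementary_Groups"
    "HOL-Algebra.Product_Groups"
begin

text \<open>
  A linear form \<open>c\<^sub>1 x\<^sub>1 + \<dots> + c\<^sub>s x\<^sub>s\<close> is given by \<open>s\<close> and \<open>c\<close>; only the values of \<open>c\<close>
  on \<open>{1..s}\<close> matter. Abelian groups are the (multiplicatively written) commutative groups
  of HOL-Algebra, so \<open>k x\<close> is written as the power of \<open>x\<close> with integer exponent \<open>k\<close>.
  An element of \<open>A\<^sup>s\<close> is a function \<open>x \<in> {1..s} \<rightarrow> A\<close>, whose values outside \<open>{1..s}\<close> are irrelevant.
\<close>

definition is_solution ::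
    "('a, 'b) monoid_scheme \<Rightarrow> nat \<Rightarrow> (nat \<Rightarrow> int) \<Rightarrow> (nat \<Rightarrow> 'a) \<Rightarrow> bool" where
  "is_solution G s c x \<longleftrightarrow>
     x \<in> {1..s} \<rightarrow> carrier G \<and> (\<Otimes>\<^bsub>G\<^esub>i\<in>{1..s}. x i [^]\<^bsub>G\<^esub> c i) = \<one>\<^bsub>G\<^esub>"

definition equality_partition :: "nat \<Rightarrow> (nat \<Rightarrow> 'a) \<Rightarrow> nat set set" where
  "equality_partition s x = {1..s} // {(i, j). i \<in> {1..s} \<and> j \<in> {1..s} \<and> x i = x j}"

definition zero_endomorphism :: "('a, 'b) monoid_scheme \<Rightarrow> int \<Rightarrow> bool" where
  "zero_endomorphism G k \<longleftrightarrow> (\<forall>g\<in>carrier G. g [^]\<^bsub>G\<^esub> k = \<one>\<^bsub>G\<^esub>)"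

definition trivial_solution ::
    "('a, 'b) monoid_scheme \<Rightarrow> nat \<Rightarrow> (nat \<Rightarrow> int) \<Rightarrow> (nat \<Rightarrow> 'a) \<Rightarrow> bool" where
  "trivial_solution G s c x \<longleftrightarrow>
     is_solution G s c x \<and> (\<forall>T\<in>equality_partition s x. zero_endomorphism G (\<Sum>i\<in>T. c i))"

definition nontrivial_solution ::
    "('a, 'b) monoid_scheme \<Rightarrow> nat \<Rightarrow> (nat \<Rightarrow> int) \<Rightarrow> (nat \<Rightarrow> 'a) \<Rightarrow> bool" where
  "nontrivial_solution G s c x \<longleftrightarrow> is_solution G s c x \<and> \<not> trivial_solution G s c x"

definition L_free ::
    "('a, 'b) monoid_scheme \<Rightarrow> nat \<Rightarrow> (nat \<Rightarrow> int) \<Rightarrow> 'a set \<Rightarrow> bool" where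
  "L_free G s c A \<longleftrightarrow>
     A \<subseteq> carrier G \<and>
     (\<forall>x \<in> {1..s} \<rightarrow> A. is_solution G s c x \<longrightarrow> trivial_solution G s c x)"

definition r_L :: "nat \<Rightarrow> (nat \<Rightarrow> int) \<Rightarrow> nat \<Rightarrow> nat" where
  "r_L s c N = Max {card A | A. A \<subseteq> {1..int N} \<and> L_free integer_group s c A}"

definition L_seed ::
    "('a, 'b) monoid_scheme \<Rightarrow> nat \<Rightarrow> (nat \<Rightarrow> int) \<Rightarrow> 'a set \<Rightarrow> bool" where
  "L_seed G s c A \<longleftrightarrow>
     A \<subseteq> carrier G \<and>
     (\<exists>f :: nat \<Rightarrow> 'a \<Rightarrow> int.
        (\<forall>x \<in> {1..s} \<rightarrow> A. trivial_solution G s c x \<longrightarrow> (\<Sum>i=1..s. f i (x i)) = 0) \<and>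
        (\<forall>x \<in> {1..s} \<rightarrow> A. nontrivial_solution G s c x \<longrightarrow> (\<Sum>i=1..s. f i (x i)) > 0))"

text \<open>
  Below, modulus \<open>m\<close> stands for the ring of integers modulo \<open>m\<close>. As in \<^const>\<open>integer_mod_group\<close>,
  \<open>m = 0\<close> gives the ring of integers, since congruence modulo \<open>0\<close> is equality.
\<close>

definition zero_sum_partition :: "nat \<Rightarrow> nat \<Rightarrow> (nat \<Rightarrow> int) \<Rightarrow> nat set set \<Rightarrow> bool" where
  "zero_sum_partition m s c P \<longleftrightarrow>
     partition_on {1..s} P \<and> (\<forall>T\<in>P. [(\<Sum>i\<in>T. c i) = 0] (mod int m))"

definition finest_zero_sum_partition :: "nat \<Rightarrow> nat \<Rightarrow> (nat \<Rightarrow> int) \<Rightarrow> nat set set \<Rightarrow> bool" where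
  "finest_zero_sum_partition m s c P \<longleftrightarrow>
     zero_sum_partition m s c P \<and>
     (\<forall>Q. zero_sum_partition m s c Q \<and> refines {1..s} Q P \<longrightarrow> Q = P)"

definition primitive_form :: "nat \<Rightarrow> nat \<Rightarrow> (nat \<Rightarrow> int) \<Rightarrow> bool" where
  "primitive_form m s c \<longleftrightarrow> (\<exists>!P. finest_zero_sum_partition m s c P)"

text \<open>Meaningful only if \<^term>\<open>primitive_form m s c\<close> holds.\<close>

definition coefficient_partition :: "nat \<Rightarrow> nat \<Rightarrow> (nat \<Rightarrow> int) \<Rightarrow> nat set set" where
  "coefficient_partition m s c = (THE P. finest_zero_sum_partition m s c P)"

definition integer_mod_power_group :: "nat \<Rightarrow> nat \<Rightarrow> (nat \<Rightarrow> int) monoid" where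
  "integer_mod_power_group m r = product_group {1..r} (\<lambda>_. integer_mod_group m)"

end

theory Submission
  imports Defs "HOL-Analysis.Harmonic_Numbers"
begin

text \<open>
  Take words of \<open>t\<close> rows with \<open>t\<close> letters from the seed \<open>A\<close> each, and read each of the \<open>r\<close>
  coordinates of a row as a \<open>t\<close>-digit number in base \<open>m\<close>. These \<open>t r\<close> numbers become the digits of
  an integer in base \<open>K m\<^sup>t\<close> with \<open>K = \<Sum>i. \<bar>c i\<bar>\<close>, which excludes carries in \<open>L\<close> from one number to
  the next. Carries inside a row are harmless: the lowest letter position at which a solution of
  \<open>L = 0\<close> is nontrivial receives no carry, because up to there equal letters make \<open>L\<close> vanish over
  the integers (the coefficient partitions over the integers and modulo \<open>m\<close> agree). Hence that
  position is a nontrivial solution modulo \<open>m\<close>, where the seed functions have positive sum.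
  Weighting the positions of a row geometrically makes this position dominate, so the weighted sums
  of the seed functions have nonnegative total over each row, with equality only for trivial
  solutions. On a set of words on which all \<open>s\<close> weighted sums are constant the total is \<open>0\<close>, as one
  sees from constant solutions, so such a set is \<open>L\<close>-free. There are only \<open>exp (O(t))\<close> possible
  values, so by pigeonhole some such set has \<open>card A ^ t\<^sup>2 * exp (- O(t))\<close> elements among the first
  \<open>m ^ (r t\<^sup>2) * exp (O(t))\<close> integers.
\<close>

section \<open>Zero-sum partitions\<close>

lemma partition_on_equality_partition: "partition_on {1..s} (equality_partition s x)"
  unfolding equality_partition_def
  by (rule partition_on_quotient) (auto simp: equiv_def refl_on_def sym_def trans_def)

lemma mem_equality_partition:
  assumes "T \<in> equality_partition s x"
  obtains i where "i \<in> {1..s}" "T = {j \<in> {1..s}. x j = x i}"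
proof -
  obtain i where "i \<in> {1..s}" "T = {(i, j). i \<in> {1..s} \<and> j \<in> {1..s} \<and> x i = x j} `` {i}"
    using assms unfolding equality_partition_def by (rule quotientE)
  then show thesis by (intro that[of i]) (auto simp: Image_def)
qed

text \<open>A block of \<open>Q\<close> is the disjoint union of the blocks of \<open>P\<close>
  inside it, so its coefficient sum is a sum of multiples of \<open>m\<close>. Zero-sum partitions
  are thus closed under coarsening.\<close>

lemma refines_zero_sum_partition:
  assumes P: "zero_sum_partition m s c P" and PQ: "refines {1..s} P Q"
  shows "zero_sum_partition m s c Q"
  unfolding zero_sum_partition_def
proof (intro conjI ballI)
  show "partition_on {1..s} Q" using PQ by (simp add: refines_def)
  fix T assume T: "T \<in> Q"
  have part: "partition_on T {p \<in> P. p \<subseteq> T}" using refines_obtains_subset[OF PQ T] .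
  have T_eq: "T = \<Union>{p \<in> P. p \<subseteq> T}" using part by (simp add: partition_on_def)
  have "T \<subseteq> {1..s}"
    using \<open>partition_on {1..s} Q\<close> T by (auto simp: partition_on_def)
  then have fin: "finite T" by (rule finite_subset) simp
  have "(\<Sum>i\<in>T. c i) = (\<Sum>p\<in>{p \<in> P. p \<subseteq> T}. \<Sum>i\<in>p. c i)"
  proof -
    have "sum c (\<Union>{p \<in> P. p \<subseteq> T}) = (sum \<circ> sum) c {p \<in> P. p \<subseteq> T}"
    proof (rule sum.Union_disjoint)
      show "\<forall>p\<in>{p \<in> P. p \<subseteq> T}. finite p" using fin finite_subset by auto
      show "\<forall>p\<in>{p \<in> P. p \<subseteq> T}. \<forall>q\<in>{p \<in> P. p \<subseteq> T}. p \<noteq> q \<longrightarrow> p \<inter> q = {}"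
        using part by (auto simp: partition_on_def disjoint_def)
    qed
    then show ?thesis using T_eq by simp
  qed
  moreover have "int m dvd (\<Sum>p\<in>{p \<in> P. p \<subseteq> T}. \<Sum>i\<in>p. c i)"
    by (rule dvd_sum) (use P in \<open>auto simp: zero_sum_partition_def cong_0_iff\<close>)
  ultimately show "[(\<Sum>i\<in>T. c i) = 0] (mod int m)" by (simp add: cong_0_iff)
qed

text \<open>There are only finitely many zero-sum refinements of \<open>Q\<close>, so one of them is
  minimal; by transitivity it is minimal among all zero-sum partitions.\<close>

lemma ex_finest_zero_sum_partition_refines:
  assumes "zero_sum_partition m s c Q"
  shows "\<exists>P. finest_zero_sum_partition m s c P \<and> refines {1..s} P Q"
proof -
  let ?Z = "{P. zero_sum_partition m s c P \<and> refines {1..s} P Q}"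
  let ?R = "\<lambda>P P'. refines {1..s} P P' \<and> P \<noteq> P'"
  have fin: "finite ?Z"
    by (rule finite_subset[of _ "Pow (Pow {1..s})"])
      (auto simp: zero_sum_partition_def partition_on_def)
  have ne: "?Z \<noteq> {}"
    using assms by (auto simp: zero_sum_partition_def intro: refines_refl)
  have "asymp_on ?Z ?R"
    by (rule asymp_onI) (meson refines_asym)
  moreover have "transp_on ?Z ?R"
    by (rule transp_onI) (meson refines_asym refines_trans)
  ultimately obtain P where "P \<in> ?Z" "\<forall>P'\<in>?Z. \<not> ?R P' P"
    using Finite_Set.bex_min_element[OF fin _ _ ne, of ?R] by blast
  then have "finest_zero_sum_partition m s c P"
    unfolding finest_zero_sum_partition_def
    by (metis (mono_tags, lifting) mem_Collect_eq refines_trans)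
  with \<open>P \<in> ?Z\<close> show ?thesis by blast
qed

text \<open>Uniqueness turns minimal into least: below every zero-sum \<open>Q\<close> lies some
  minimal one, and that can only be the coefficient partition.\<close>

lemma primitive_coefficient_partition:
  assumes "primitive_form m s c"
  shows "zero_sum_partition m s c (coefficient_partition m s c)"
    and "zero_sum_partition m s c Q \<Longrightarrow> refines {1..s} (coefficient_partition m s c) Q"
proof -
  have "finest_zero_sum_partition m s c (coefficient_partition m s c)"
    using assms unfolding primitive_form_def coefficient_partition_def by (rule theI')
  then show "zero_sum_partition m s c (coefficient_partition m s c)"
    by (simp add: finest_zero_sum_partition_def)
  show "refines {1..s} (coefficient_partition m s c) Q" if "zero_sum_partition m s c Q"
    using ex_finest_zero_sum_partition_refines[OF that] assms
      \<open>finest_zero_sum_partition m s c (coefficient_partition m s c)\<close>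
    unfolding primitive_form_def by metis
qed

lemma refines_equality_partitionD:
  assumes "refines {1..s} P (equality_partition s x)" "p \<in> P" "i \<in> p" "j \<in> p"
  shows "x i = x j"
proof -
  obtain T where "T \<in> equality_partition s x" "p \<subseteq> T"
    using assms by (auto simp: refines_def)
  then show ?thesis using assms(3,4)
    by (elim mem_equality_partition) (metis (mono_tags, lifting) mem_Collect_eq subsetD)
qed

lemma refines_equality_partitionI:
  assumes "partition_on {1..s} P" "\<And>p i j. p \<in> P \<Longrightarrow> i \<in> p \<Longrightarrow> j \<in> p \<Longrightarrow> x i = x j"
  shows "refines {1..s} P (equality_partition s x)"
  unfolding refines_def
proof (intro conjI ballI assms(1) partition_on_equality_partition)
  fix p assume p: "p \<in> P"
  then obtain i where i: "i \<in> p" "i \<in> {1..s}"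
    using assms(1) unfolding partition_on_def by (metis Union_iff ex_in_conv)
  have "{j \<in> {1..s}. x j = x i} \<in> equality_partition s x"
    unfolding equality_partition_def using i(2)
    by (rule quotientI[THEN back_subst[of "\<lambda>T. T \<in> _"]]) (use i in \<open>auto simp: Image_def\<close>)
  moreover have "p \<subseteq> {j \<in> {1..s}. x j = x i}"
    using assms(2)[OF p _ i(1)] partition_onD1[OF assms(1)] p by blast
  ultimately show "\<exists>Y\<in>equality_partition s x. p \<subseteq> Y" by blast
qed

text \<open>On a block of the equality partition \<open>g (x i)\<close> is constant and factors out
  of a vanishing coefficient sum. The function \<open>g\<close> will be the identity for integers
  and a coordinate for letters.\<close>

lemma sum_zero_if_zero_sum_equality_partition:
  fixes g :: "'a \<Rightarrow> int"
  assumes "zero_sum_partition 0 s c (equality_partition s x)"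
  shows "(\<Sum>i=1..s. c i * g (x i)) = 0"
proof -
  let ?P = "equality_partition s x"
  have part: "partition_on {1..s} ?P" by (rule partition_on_equality_partition)
  have U: "{1..s} = \<Union>?P" using part by (simp add: partition_on_def)
  have "(\<Sum>i\<in>\<Union>?P. c i * g (x i)) = (sum \<circ> sum) (\<lambda>i. c i * g (x i)) ?P"
  proof (rule sum.Union_disjoint)
    show "\<forall>p\<in>?P. finite p" by (auto elim!: mem_equality_partition)
    show "\<forall>p\<in>?P. \<forall>q\<in>?P. p \<noteq> q \<longrightarrow> p \<inter> q = {}"
      using part by (auto simp: partition_on_def disjoint_def)
  qed
  also have "\<dots> = (\<Sum>p\<in>?P. 0)"
    unfolding comp_def
  proof (rule sum.cong[OF refl])
    fix p assume p: "p \<in> ?P"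
    then obtain i where i: "p = {j \<in> {1..s}. x j = x i}" by (rule mem_equality_partition)
    have "(\<Sum>j\<in>p. c j * g (x j)) = (\<Sum>j\<in>p. c j) * g (x i)"
      unfolding sum_distrib_right by (rule sum.cong) (auto simp: i)
    also have "(\<Sum>j\<in>p. c j) = 0"
      using assms p by (simp add: zero_sum_partition_def cong_def)
    finally show "(\<Sum>j\<in>p. c j * g (x j)) = 0" by simp
  qed
  finally show ?thesis using U by simp
qed

section \<open>The groups of integers and of residue vectors\<close>

lemma finprod_integer_group:
  "finite I \<Longrightarrow> (\<Otimes>\<^bsub>integer_group\<^esub>i\<in>I. g i) = (\<Sum>i\<in>I. g i)"
proof (induction I rule: finite_induct)
  case empty
  interpret comm_group integer_group by (rule abelian_integer_group)
  show ?case by simp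
next
  case (insert a I)
  interpret comm_group integer_group by (rule abelian_integer_group)
  show ?case using insert by (subst finprod_insert) auto
qed

lemma is_solution_integer_group:
  "is_solution integer_group s c x \<longleftrightarrow> (\<Sum>i=1..s. c i * x i) = 0"
  by (simp add: is_solution_def finprod_integer_group)

lemma trivial_solution_integer_groupI:
  assumes "zero_sum_partition 0 s c (equality_partition s x)"
  shows "trivial_solution integer_group s c x"
  unfolding trivial_solution_def
proof (intro conjI ballI)
  show "is_solution integer_group s c x"
    using sum_zero_if_zero_sum_equality_partition[OF assms, of id]
    by (simp add: is_solution_integer_group)
  show "zero_endomorphism integer_group (\<Sum>i\<in>T. c i)" if "T \<in> equality_partition s x" for T
    using assms that by (simp add: zero_endomorphism_def zero_sum_partition_def cong_def)
qed

lemma carrier_integer_mod_power_group: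
  "m > 0 \<Longrightarrow> carrier (integer_mod_power_group m r) = {1..r} \<rightarrow>\<^sub>E {0..<int m}"
  by (simp add: integer_mod_power_group_def carrier_integer_mod_group)

lemma comm_group_integer_mod_power_group: "comm_group (integer_mod_power_group m r)"
  unfolding integer_mod_power_group_def
proof (rule group.group_comm_groupI)
  show "group (product_group {1..r} (\<lambda>_. integer_mod_group m))" by simp
qed (auto simp: add.commute)

lemma coordinate_hom_integer_mod_power_group:
  "l \<in> {1..r} \<Longrightarrow> (\<lambda>x. x l) \<in> hom (integer_mod_power_group m r) (integer_mod_group m)"
  by (auto simp: hom_def integer_mod_power_group_def)

lemma int_pow_integer_mod_power_group:
  assumes "x \<in> carrier (integer_mod_power_group m r)" "l \<in> {1..r}"
  shows "(x [^]\<^bsub>integer_mod_power_group m r\<^esub> (k::int)) l = (k * x l) mod int m"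
proof -
  interpret comm_group "integer_mod_power_group m r" by (rule comm_group_integer_mod_power_group)
  interpret group_hom "integer_mod_power_group m r" "integer_mod_group m" "\<lambda>x. x l"
    using coordinate_hom_integer_mod_power_group[OF assms(2)]
    by (auto simp: group_hom_def group_hom_axioms_def)
  show ?thesis using hom_int_pow[OF assms(1), of k] by (simp add: int_pow_integer_mod_group)
qed

lemma finprod_integer_mod_power_group:
  assumes "finite I" "g \<in> I \<rightarrow> carrier (integer_mod_power_group m r)" "l \<in> {1..r}"
  shows "(\<Otimes>\<^bsub>integer_mod_power_group m r\<^esub>i\<in>I. g i) l = (\<Sum>i\<in>I. g i l) mod int m"
  using assms
proof (induction I rule: finite_induct)
  case empty
  interpret comm_group "integer_mod_power_group m r" by (rule comm_group_integer_mod_power_group)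
  show ?case using empty by simp (simp add: integer_mod_power_group_def)
next
  case (insert a I)
  interpret comm_group "integer_mod_power_group m r" by (rule comm_group_integer_mod_power_group)
  have "finprod (integer_mod_power_group m r) g (insert a I) l
      = (g a \<otimes>\<^bsub>integer_mod_power_group m r\<^esub> finprod (integer_mod_power_group m r) g I) l"
    using insert by (subst finprod_insert) auto
  also have "\<dots> = (g a l + finprod (integer_mod_power_group m r) g I l) mod int m"
    using \<open>l \<in> {1..r}\<close> by (simp add: integer_mod_power_group_def)
  also have "\<dots> = (\<Sum>i\<in>insert a I. g i l) mod int m"
    using insert by (simp add: mod_add_right_eq)
  finally show ?case .
qed

text \<open>Group elements are extensional functions, so the product can be compared with the
  identity one coordinate at a time, where it is the combination reduced modulo
  \<open>m\<close>.\<close>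

lemma is_solution_integer_mod_power_groupI:
  assumes m: "m > 0" and x: "x \<in> {1..s} \<rightarrow> carrier (integer_mod_power_group m r)"
    and dvd: "\<And>l. l \<in> {1..r} \<Longrightarrow> int m dvd (\<Sum>i=1..s. c i * x i l)"
  shows "is_solution (integer_mod_power_group m r) s c x"
  unfolding is_solution_def
proof (intro conjI x)
  let ?G = "integer_mod_power_group m r"
  interpret comm_group ?G by (rule comm_group_integer_mod_power_group)
  let ?p = "\<Otimes>\<^bsub>?G\<^esub>i\<in>{1..s}. x i [^]\<^bsub>?G\<^esub> c i"
  have p: "(\<lambda>i. x i [^]\<^bsub>?G\<^esub> c i) \<in> {1..s} \<rightarrow> carrier ?G" using x by auto
  show "?p = \<one>\<^bsub>?G\<^esub>"
  proof (rule PiE_ext)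
    show "?p \<in> {1..r} \<rightarrow>\<^sub>E {0..<int m}"
      using finprod_closed[OF p] by (simp only: carrier_integer_mod_power_group[OF m])
    show "\<one>\<^bsub>?G\<^esub> \<in> {1..r} \<rightarrow>\<^sub>E {0..<int m}"
      using one_closed by (simp only: carrier_integer_mod_power_group[OF m])
    fix l assume l: "l \<in> {1..r}"
    have "?p l = (\<Sum>i=1..s. (x i [^]\<^bsub>?G\<^esub> c i) l) mod int m"
      using finprod_integer_mod_power_group[OF _ p l] by simp
    also have "\<dots> = (\<Sum>i=1..s. (c i * x i l) mod int m) mod int m"
      by (intro arg_cong[of _ _ "\<lambda>a. a mod int m"] sum.cong refl int_pow_integer_mod_power_group)
        (use x l in auto)
    also have "\<dots> = 0" using dvd[OF l] by (simp add: mod_sum_eq)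
    also have "\<dots> = \<one>\<^bsub>?G\<^esub> l" using l by (simp add: integer_mod_power_group_def)
    finally show "?p l = \<one>\<^bsub>?G\<^esub> l" .
  qed
qed

text \<open>The all-ones vector is the witness: each coordinate of its power with exponent
  \<open>k\<close> is \<open>k mod m\<close>.\<close>

lemma zero_endomorphism_integer_mod_power_groupD:
  assumes "m \<ge> 2" "r \<ge> 1" and zero: "zero_endomorphism (integer_mod_power_group m r) k"
  shows "int m dvd k"
proof -
  let ?e = "\<lambda>l\<in>{1..r}. (1::int)"
  have e: "?e \<in> carrier (integer_mod_power_group m r)"
    using assms by (subst carrier_integer_mod_power_group) auto
  have "(k * ?e 1) mod int m = \<one>\<^bsub>integer_mod_power_group m r\<^esub> 1"
    using zero e int_pow_integer_mod_power_group[OF e, of 1 k] \<open>r \<ge> 1\<close>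
    by (simp add: zero_endomorphism_def)
  then show ?thesis using \<open>r \<ge> 1\<close> by (simp add: integer_mod_power_group_def dvd_eq_mod_eq_0)
qed

lemma trivial_solution_integer_mod_power_groupD:
  assumes "m \<ge> 2" "r \<ge> 1" "trivial_solution (integer_mod_power_group m r) s c x"
  shows "zero_sum_partition m s c (equality_partition s x)"
  using assms zero_endomorphism_integer_mod_power_groupD partition_on_equality_partition
  unfolding trivial_solution_def zero_sum_partition_def cong_0_iff by blast

section \<open>Digit expansions\<close>

text \<open>The lowest digit is divisible by \<open>q\<close> and smaller than \<open>q\<close> in
  absolute value, hence zero; dividing by \<open>q\<close> gives the induction. Signed digits are
  allowed, so the lemma serves for differences and for linear combinations of expansions.\<close>

lemma radix_expansion_eq_0D:
  fixes y :: "nat \<Rightarrow> int"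
  assumes "\<And>i. i < n \<Longrightarrow> \<bar>y i\<bar> < q" "(\<Sum>i<n. q ^ i * y i) = 0" "i < n"
  shows "y i = 0"
  using assms
proof (induction n arbitrary: y i)
  case (Suc n)
  have q: "q > 0" using Suc.prems(1)[of 0] by simp
  have eq: "y 0 + q * (\<Sum>i<n. q ^ i * y (Suc i)) = 0"
    using Suc.prems(2) by (simp del: sum.lessThan_Suc add: sum.lessThan_Suc_shift sum_distrib_left mult.assoc)
  then have "q dvd y 0" by (metis dvd_add_left_iff dvd_0_right dvd_triv_left)
  then have y0: "y 0 = 0"
    using Suc.prems(1)[of 0] dvd_imp_le_int[of "y 0" q] by auto
  then have "(\<Sum>i<n. q ^ i * y (Suc i)) = 0" using eq q by simp
  then have "y (Suc j) = 0" if "j < n" for j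
    using Suc.IH[of "\<lambda>i. y (Suc i)" j] Suc.prems(1) that by simp
  with y0 show ?case using Suc.prems(3) by (cases i) auto
qed simp

lemma radix_expansion_bounds:
  fixes y :: "nat \<Rightarrow> int"
  assumes "\<And>i. i < n \<Longrightarrow> 0 \<le> y i \<and> y i < q"
  shows "0 \<le> (\<Sum>i<n. q ^ i * y i) \<and> (\<Sum>i<n. q ^ i * y i) < q ^ n"
  using assms
proof (induction n)
  case (Suc n)
  have y: "0 \<le> y n" "y n + 1 \<le> q" using Suc.prems[of n] by auto
  then have "q ^ n * (y n + 1) \<le> q ^ n * q" by (intro mult_left_mono) auto
  moreover have "0 \<le> q ^ n * y n" using y by simp
  ultimately show ?case using Suc by (simp add: algebra_simps)
qed simp

text \<open>The extreme case is \<open>g j = - (B - 1)\<close> throughout, where the geometric sum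
  telescopes to \<open>1 - B ^ k\<close>.\<close>

lemma geometric_weights_lower_bound:
  fixes g :: "nat \<Rightarrow> int"
  assumes "\<And>j. j < k \<Longrightarrow> g j \<ge> - (B - 1)" "B \<ge> 1"
  shows "(\<Sum>j<k. B ^ (k - 1 - j) * g j) \<ge> 1 - B ^ k"
  using assms
proof (induction k arbitrary: g)
  case (Suc k)
  have "B ^ k * g 0 \<ge> B ^ k * - (B - 1)" using Suc.prems by (intro mult_left_mono) auto
  moreover have "(\<Sum>j<k. B ^ (k - 1 - j) * g (Suc j)) \<ge> 1 - B ^ k"
    using Suc.prems by (intro Suc.IH) auto
  ultimately show ?case by (simp del: sum.lessThan_Suc add: sum.lessThan_Suc_shift algebra_simps)
qed simp

text \<open>Below the lowest digit position at which \<open>triv\<close> fails there are no carries, so \<open>D\<close> still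
  vanishes modulo \<open>m\<close> at that position; its weight dominates all higher ones.\<close>

lemma digitwise_trivial:
  fixes g :: "nat \<Rightarrow> int" and D :: "nat \<Rightarrow> 'l \<Rightarrow> int"
  assumes "\<And>l. l \<in> R \<Longrightarrow> (\<Sum>j<k. m ^ j * D j l) = 0"
    and "\<And>j. \<lbrakk>j < k; triv j\<rbrakk> \<Longrightarrow> g j = 0 \<and> (\<forall>l\<in>R. D j l = 0)"
    and "\<And>j. \<lbrakk>j < k; \<forall>l\<in>R. m dvd D j l; \<not> triv j\<rbrakk> \<Longrightarrow> g j > 0"
    and "\<And>j. j < k \<Longrightarrow> g j \<ge> - (B - 1)"
    and "B \<ge> 1" "m > 0"
  shows "(\<Sum>j<k. B ^ (k - 1 - j) * g j) \<ge> 0 \<and>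
    ((\<Sum>j<k. B ^ (k - 1 - j) * g j) = 0 \<longrightarrow> (\<forall>j<k. triv j))"
  using assms
proof (induction k arbitrary: D g triv)
  case (Suc k)
  let ?S = "\<Sum>j<k. B ^ (k - 1 - j) * g (Suc j)"
  have shift: "(\<Sum>j<Suc k. B ^ (Suc k - 1 - j) * g j) = B ^ k * g 0 + ?S"
    by (simp del: sum.lessThan_Suc add: sum.lessThan_Suc_shift)
  have eq: "D 0 l + m * (\<Sum>j<k. m ^ j * D (Suc j) l) = 0" if "l \<in> R" for l
    using Suc.prems(1)[OF that]
    by (simp del: sum.lessThan_Suc add: sum.lessThan_Suc_shift sum_distrib_left mult.assoc)
  show ?case
  proof (cases "triv 0")
    \<comment> \<open>A trivial lowest position contributes zero to both expansions, so it is
      removed and the equation divided by \<open>m\<close>.\<close>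
    case True
    then have 0: "g 0 = 0" "\<And>l. l \<in> R \<Longrightarrow> D 0 l = 0" using Suc.prems(2)[of 0] by auto
    have "(\<Sum>j<k. m ^ j * D (Suc j) l) = 0" if "l \<in> R" for l
      using eq[OF that] 0 that \<open>m > 0\<close> by simp
    then have "?S \<ge> 0 \<and> (?S = 0 \<longrightarrow> (\<forall>j<k. triv (Suc j)))"
      using Suc.prems(2-) by (intro Suc.IH[where D = "\<lambda>j. D (Suc j)"]) auto
    with True 0 show ?thesis unfolding shift by (auto simp: less_Suc_eq_0_disj)
  next
    case False
    have "\<forall>l\<in>R. m dvd D 0 l"
      using eq by (metis dvd_add_left_iff dvd_0_right dvd_triv_left)
    then have "g 0 \<ge> 1" using Suc.prems(3)[of 0] False by auto
    then have "B ^ k * g 0 \<ge> B ^ k * 1" using \<open>B \<ge> 1\<close> by (intro mult_left_mono) auto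
    \<comment> \<open>The other positions lose at most \<open>B ^ k - 1\<close> against a gain of at
      least \<open>B ^ k\<close>. The total is positive, so the equality case does not
      arise.\<close>
    moreover have "?S \<ge> 1 - B ^ k"
      using Suc.prems by (intro geometric_weights_lower_bound) auto
    ultimately show ?thesis unfolding shift by auto
  qed
qed simp

section \<open>Level sets of words over a seed\<close>

text \<open>The only equality class is all of \<open>{1..s}\<close>, whose coefficient sum is zero
  by translation invariance.\<close>

lemma trivial_solution_const:
  assumes "m > 0" and a: "a \<in> carrier (integer_mod_power_group m r)" and "(\<Sum>i=1..s. c i) = 0"
  shows "trivial_solution (integer_mod_power_group m r) s c (\<lambda>_. a)"
  unfolding trivial_solution_def
proof (intro conjI ballI)
  show "is_solution (integer_mod_power_group m r) s c (\<lambda>_. a)"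
    using assms by (intro is_solution_integer_mod_power_groupI) (auto simp flip: sum_distrib_right)
  fix T assume "T \<in> equality_partition s (\<lambda>_. a)"
  then have "T = {1..s}" by (elim mem_equality_partition) auto
  then show "zero_endomorphism (integer_mod_power_group m r) (\<Sum>i\<in>T. c i)"
    using assms(3) by (simp add: zero_endomorphism_def)
qed

text \<open>A word \<open>w\<close> consists of \<open>d\<close> rows of \<open>k\<close> letters, each letter being a vector with \<open>r\<close>
  coordinates. Coordinate \<open>l\<close> of row \<open>b\<close>, read as a \<open>k\<close>-digit number in base \<open>m\<close>, is the block
  with index \<open>b * r + (l - 1)\<close>.\<close>

definition word_block :: "nat \<Rightarrow> nat \<Rightarrow> nat \<Rightarrow> (nat \<times> nat \<Rightarrow> nat \<Rightarrow> int) \<Rightarrow> nat \<Rightarrow> int" where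
  "word_block m r k w p = (\<Sum>j<k. int m ^ j * w (p div r, j) (p mod r + 1))"

definition word_value ::
    "int \<Rightarrow> nat \<Rightarrow> nat \<Rightarrow> nat \<Rightarrow> nat \<Rightarrow> (nat \<times> nat \<Rightarrow> nat \<Rightarrow> int) \<Rightarrow> int" where
  "word_value q m r d k w = (\<Sum>p<d * r. q ^ p * word_block m r k w p)"

text \<open>Coordinates are numbered from 1 while remainders modulo \<open>r\<close> start at 0;
  hence the shift by one.\<close>

lemma block_index:
  fixes l r b d :: nat
  assumes "l \<in> {1..r}" "b < d"
  shows "b * r + (l - 1) < d * r" "(b * r + (l - 1)) div r = b" "(b * r + (l - 1)) mod r + 1 = l"
proof -
  have l: "l - 1 < r" using assms(1) by (cases l) auto
  have "b * r + (l - 1) < (b + 1) * r" using l by simp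
  also have "\<dots> \<le> d * r" using assms(2) by (intro mult_right_mono) auto
  finally show "b * r + (l - 1) < d * r" .
  show "(b * r + (l - 1)) div r = b" "(b * r + (l - 1)) mod r + 1 = l"
    using l assms(1) by (simp_all add: div_mult_self3 mod_mult_self3 del: add_diff_assoc One_nat_def)
qed

lemma word_block_index:
  assumes "l \<in> {1..r}" "b < d"
  shows "word_block m r k w (b * r + (l - 1)) = (\<Sum>j<k. int m ^ j * w (b, j) l)"
  by (simp only: word_block_def block_index[OF assms])

section \<open>Bounds and injectivity of the encoding of words by integers\<close>

context
  fixes m r d k :: nat and A :: "(nat \<Rightarrow> int) set"
  assumes m: "m \<ge> 2" and r: "r \<ge> 1"
    and A: "A \<subseteq> carrier (integer_mod_power_group m r)"
begin

lemma letter_bounds: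
  assumes "a \<in> A" "l \<in> {1..r}"
  shows "0 \<le> a l" "a l < int m"
  using assms A m by (auto simp: carrier_integer_mod_power_group PiE_iff subset_iff)

lemma word_block_bounds:
  assumes "w \<in> {..<d} \<times> {..<k} \<rightarrow>\<^sub>E A" "p < d * r"
  shows "0 \<le> word_block m r k w p" "word_block m r k w p < int m ^ k"
proof -
  have "w (p div r, j) \<in> A" if "j < k" for j
    using assms that r by (auto simp: PiE_iff less_mult_imp_div_less)
  moreover have "p mod r + 1 \<in> {1..r}"
    using mod_less_divisor[of r p] r by (simp add: Suc_le_eq)
  ultimately have "0 \<le> word_block m r k w p \<and> word_block m r k w p < int m ^ k"
    unfolding word_block_def
    by (intro radix_expansion_bounds conjI letter_bounds) auto
  then show "0 \<le> word_block m r k w p" "word_block m r k w p < int m ^ k" by auto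
qed

lemma word_value_bounds:
  assumes "w \<in> {..<d} \<times> {..<k} \<rightarrow>\<^sub>E A" "q \<ge> int m ^ k"
  shows "0 \<le> word_value q m r d k w" "word_value q m r d k w < q ^ (d * r)"
proof -
  have "0 \<le> word_block m r k w p \<and> word_block m r k w p < q" if "p < d * r" for p
    using word_block_bounds[OF assms(1) that] assms(2) by linarith
  then show "0 \<le> word_value q m r d k w" "word_value q m r d k w < q ^ (d * r)"
    using radix_expansion_bounds unfolding word_value_def by blast+
qed

text \<open>Uniqueness of expansions is used twice on differences: in base \<open>q\<close> to
  recover the blocks, then in base \<open>m\<close> to recover the letters from the blocks.\<close>

lemma inj_on_word_value:
  assumes "q \<ge> int m ^ k"
  shows "inj_on (word_value q m r d k) ({..<d} \<times> {..<k} \<rightarrow>\<^sub>E A)"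
proof (rule inj_onI)
  fix v w assume v: "v \<in> {..<d} \<times> {..<k} \<rightarrow>\<^sub>E A" and w: "w \<in> {..<d} \<times> {..<k} \<rightarrow>\<^sub>E A"
    and eq: "word_value q m r d k v = word_value q m r d k w"
  have block: "word_block m r k v p - word_block m r k w p = 0" if "p < d * r" for p
  proof (rule radix_expansion_eq_0D[where n = "d * r" and q = q and i = p
        and y = "\<lambda>p. word_block m r k v p - word_block m r k w p"])
    show "(\<Sum>p<d * r. q ^ p * (word_block m r k v p - word_block m r k w p)) = 0"
      using eq by (simp add: word_value_def right_diff_distrib sum_subtractf)
    fix p assume "p < d * r"
    then show "\<bar>word_block m r k v p - word_block m r k w p\<bar> < q"
      using word_block_bounds[OF v, of p] word_block_bounds[OF w, of p] assms by linarith
  qed (rule that)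
  show "v = w"
  proof (rule PiE_ext[OF v w])
    fix bj assume bj: "bj \<in> {..<d} \<times> {..<k}"
    obtain b j where [simp]: "bj = (b, j)" by (cases bj)
    have bd: "b < d" and jk: "j < k" using bj by auto
    have vw: "v (b, i) \<in> A" "w (b, i) \<in> A" if "i < k" for i
      using v w bd that by auto
    have "v (b, j) \<in> {1..r} \<rightarrow>\<^sub>E {0..<int m}" "w (b, j) \<in> {1..r} \<rightarrow>\<^sub>E {0..<int m}"
      using vw[OF jk] A m by (auto simp: carrier_integer_mod_power_group)
    then have "v (b, j) = w (b, j)"
    proof (rule PiE_ext)
      fix l assume l: "l \<in> {1..r}"
      have "v (b, j) l - w (b, j) l = 0"
      proof (rule radix_expansion_eq_0D[where n = k and q = "int m" and i = j
            and y = "\<lambda>j. v (b, j) l - w (b, j) l"])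
        show "(\<Sum>j<k. int m ^ j * (v (b, j) l - w (b, j) l)) = 0"
          using block[OF block_index(1)[OF l bd]] unfolding word_block_index[OF l bd]
          by (simp add: right_diff_distrib sum_subtractf)
        fix i assume "i < k"
        then show "\<bar>v (b, i) l - w (b, i) l\<bar> < int m"
          using letter_bounds[OF vw(1) l, of i] letter_bounds[OF vw(2) l, of i] by linarith
      qed (rule jk)
      then show "v (b, j) l = w (b, j) l" by simp
    qed
    then show "v bj = w bj" by simp
  qed
qed

end

section \<open>Weights of words and their level sets\<close>

locale seeded_form =
  fixes s m r :: nat and c :: "nat \<Rightarrow> int" and A :: "(nat \<Rightarrow> int) set"
    and f :: "nat \<Rightarrow> (nat \<Rightarrow> int) \<Rightarrow> int"
  assumes s: "s \<ge> 1" and c_nz: "\<forall>i\<in>{1..s}. c i \<noteq> 0"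
    and c_sum: "(\<Sum>i=1..s. c i) = 0"
    and m: "m \<ge> 2" and r: "r \<ge> 1"
    and prim: "primitive_form m s c" "primitive_form 0 s c"
      "coefficient_partition m s c = coefficient_partition 0 s c"
    and A: "A \<subseteq> carrier (integer_mod_power_group m r)"
    and f_trivial: "x \<in> {1..s} \<rightarrow> A \<Longrightarrow> trivial_solution (integer_mod_power_group m r) s c x
      \<Longrightarrow> (\<Sum>i=1..s. f i (x i)) = 0"
    and f_nontrivial: "x \<in> {1..s} \<rightarrow> A \<Longrightarrow> nontrivial_solution (integer_mod_power_group m r) s c x
      \<Longrightarrow> (\<Sum>i=1..s. f i (x i)) > 0"
begin

definition K :: int where "K = (\<Sum>i=1..s. \<bar>c i\<bar>)"

text \<open>Chosen so that \<open>B - 1\<close> bounds the sum over \<open>i\<close> of the absolute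
  values of the \<open>f i\<close> at any choice of letters. This is the bound that the geometric
  weights require.\<close>

definition B :: int where "B = 1 + (\<Sum>i=1..s. \<Sum>a\<in>A. \<bar>f i a\<bar>)"

definition row_weight :: "nat \<Rightarrow> nat \<Rightarrow> (nat \<times> nat \<Rightarrow> nat \<Rightarrow> int) \<Rightarrow> nat \<Rightarrow> int" where
  "row_weight k i w b = (\<Sum>j<k. B ^ (k - 1 - j) * f i (w (b, j)))"

definition weight :: "nat \<Rightarrow> nat \<Rightarrow> nat \<Rightarrow> (nat \<times> nat \<Rightarrow> nat \<Rightarrow> int) \<Rightarrow> int" where
  "weight d k i w = (\<Sum>b<d. row_weight k i w b)"

lemma K_ge_1: "K \<ge> 1"
proof -
  have "\<bar>c 1\<bar> \<le> K" unfolding K_def by (rule member_le_sum) (use s in auto)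
  moreover have "c 1 \<noteq> 0" using c_nz s by simp
  ultimately show ?thesis by linarith
qed

lemma finite_A: "finite A"
proof (rule finite_subset[OF A])
  have "finite ({1..r} \<rightarrow>\<^sub>E {0..<int m})" by (intro finite_PiE) auto
  then show "finite (carrier (integer_mod_power_group m r))"
    using m by (simp add: carrier_integer_mod_power_group)
qed

lemma B_ge_1: "B \<ge> 1"
  unfolding B_def by (simp add: sum_nonneg)

lemma sum_abs_f_le:
  assumes "x \<in> {1..s} \<rightarrow> A"
  shows "(\<Sum>i=1..s. \<bar>f i (x i)\<bar>) \<le> B - 1"
  unfolding B_def using assms finite_A
  by (auto intro!: sum_mono member_le_sum[of _ A])

lemma abs_f_le:
  assumes "i \<in> {1..s}" "a \<in> A"
  shows "\<bar>f i a\<bar> \<le> B - 1"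
proof -
  have "\<bar>f i a\<bar> \<le> (\<Sum>i=1..s. \<bar>f i a\<bar>)"
    using assms by (intro member_le_sum[of i _ "\<lambda>i. \<bar>f i a\<bar>"]) auto
  also have "\<dots> \<le> B - 1" using sum_abs_f_le[of "\<lambda>_. a"] assms by simp
  finally show ?thesis .
qed

text \<open>The geometric lower bound is applied both to \<open>f i\<close> and to its
  negative.\<close>

lemma abs_row_weight_le:
  assumes "i \<in> {1..s}" "\<And>j. j < k \<Longrightarrow> w (b, j) \<in> A"
  shows "\<bar>row_weight k i w b\<bar> \<le> B ^ k"
proof -
  have bd: "\<bar>f i (w (b, j))\<bar> \<le> B - 1" if "j < k" for j
    using abs_f_le assms that by blast
  have "1 - B ^ k \<le> (\<Sum>j<k. B ^ (k - 1 - j) * f i (w (b, j)))"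
    using bd B_ge_1 by (intro geometric_weights_lower_bound) (force simp: abs_le_iff)+
  moreover have "1 - B ^ k \<le> (\<Sum>j<k. B ^ (k - 1 - j) * - f i (w (b, j)))"
    using bd B_ge_1 by (intro geometric_weights_lower_bound) (force simp: abs_le_iff)+
  ultimately show ?thesis unfolding row_weight_def by (simp add: sum_negf abs_le_iff)
qed

lemma abs_weight_le:
  assumes "i \<in> {1..s}" "w \<in> {..<d} \<times> {..<k} \<rightarrow>\<^sub>E A"
  shows "\<bar>weight d k i w\<bar> \<le> int d * B ^ k"
proof -
  have "\<bar>weight d k i w\<bar> \<le> (\<Sum>b<d. \<bar>row_weight k i w b\<bar>)"
    unfolding weight_def by (rule sum_abs)
  also have "\<dots> \<le> (\<Sum>b<d. B ^ k)"
    using assms by (intro sum_mono abs_row_weight_le) auto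
  finally show ?thesis by simp
qed

lemma sum_weight:
  "(\<Sum>i=1..s. weight d k i (w i)) =
   (\<Sum>b<d. \<Sum>j<k. B ^ (k - 1 - j) * (\<Sum>i=1..s. f i (w i (b, j))))"
proof -
  have "(\<Sum>i=1..s. weight d k i (w i)) = (\<Sum>b<d. \<Sum>i=1..s. row_weight k i (w i) b)"
    unfolding weight_def by (rule sum.swap)
  also have "\<dots> = (\<Sum>b<d. \<Sum>j<k. \<Sum>i=1..s. B ^ (k - 1 - j) * f i (w i (b, j)))"
    unfolding row_weight_def by (rule sum.cong[OF refl], rule sum.swap)
  finally show ?thesis by (simp only: sum_distrib_left)
qed

text \<open>Constant solutions are trivial, so the seed functions sum to zero at every single
  letter.\<close>

lemma sum_weight_diagonal:
  assumes "w \<in> {..<d} \<times> {..<k} \<rightarrow>\<^sub>E A"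
  shows "(\<Sum>i=1..s. weight d k i w) = 0"
proof -
  have "(\<Sum>i=1..s. f i (w (b, j))) = 0" if "b < d" "j < k" for b j
  proof -
    have "w (b, j) \<in> A" using assms that by auto
    then show ?thesis
      using f_trivial[of "\<lambda>_. w (b, j)"] trivial_solution_const[OF _ _ c_sum, of m "w (b, j)" r] A m
      by auto
  qed
  then show ?thesis unfolding sum_weight[of d k "\<lambda>_. w"] by simp
qed

text \<open>The passage from \<open>m\<close> to the integers: the equality partition is zero-sum
  modulo \<open>m\<close>, so it is coarser than the coefficient partition modulo \<open>m\<close>,
  which is also the one over the integers.\<close>

lemma coefficient_partition_refines_if_trivial:
  assumes "trivial_solution (integer_mod_power_group m r) s c x"
  shows "refines {1..s} (coefficient_partition 0 s c) (equality_partition s x)"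
  using primitive_coefficient_partition(2)[OF prim(1)]
    trivial_solution_integer_mod_power_groupD[OF m r assms] prim(3) by simp

text \<open>A trivial position vanishes over the integers and not only modulo \<open>m\<close>, so
  it passes no carry to the next position.\<close>

lemma combination_eq_0_if_trivial:
  assumes "trivial_solution (integer_mod_power_group m r) s c x"
  shows "(\<Sum>i=1..s. c i * x i l) = 0"
  using sum_zero_if_zero_sum_equality_partition[of s c x "\<lambda>a. a l"]
    refines_zero_sum_partition[OF primitive_coefficient_partition(1)[OF prim(2)]
      coefficient_partition_refines_if_trivial[OF assms]] by simp

lemma solution_words_trivial:
  assumes w: "\<And>i. i \<in> {1..s} \<Longrightarrow> w i \<in> {..<d} \<times> {..<k} \<rightarrow>\<^sub>E A"
    and level: "\<And>i i'. i \<in> {1..s} \<Longrightarrow> i' \<in> {1..s} \<Longrightarrow> weight d k i' (w i) = weight d k i' (w 1)"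
    and sol: "(\<Sum>i=1..s. c i * word_value (K * int m ^ k) m r d k (w i)) = 0"
    and bj: "b < d" "j < k"
  shows "trivial_solution (integer_mod_power_group m r) s c (\<lambda>i. w i (b, j))"
proof -
  let ?G = "integer_mod_power_group m r" and ?q = "K * int m ^ k"
  let ?g = "\<lambda>b j. \<Sum>i=1..s. f i (w i (b, j))"
  let ?row = "\<lambda>b. \<Sum>j<k. B ^ (k - 1 - j) * ?g b j"
  have wA: "(\<lambda>i. w i (b, j)) \<in> {1..s} \<rightarrow> A" if "b < d" "j < k" for b j
    using w that by fastforce
  \<comment> \<open>Blocks are at most \<open>m ^ k - 1\<close>, so their combination is at most
    \<open>K * (m ^ k - 1)\<close> in absolute value, which is below the base; hence it vanishes for
    each \<open>p\<close> separately.\<close>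
  have block: "(\<Sum>i=1..s. c i * word_block m r k (w i) p) = 0" if "p < d * r" for p
  proof (rule radix_expansion_eq_0D[where n = "d * r" and q = ?q and i = p
        and y = "\<lambda>p. \<Sum>i=1..s. c i * word_block m r k (w i) p"])
    have "(\<Sum>p<d * r. ?q ^ p * (\<Sum>i=1..s. c i * word_block m r k (w i) p))
        = (\<Sum>p<d * r. \<Sum>i=1..s. c i * (?q ^ p * word_block m r k (w i) p))"
      by (simp add: sum_distrib_left mult.left_commute)
    also have "\<dots> = (\<Sum>i=1..s. c i * word_value ?q m r d k (w i))"
      unfolding word_value_def sum_distrib_left by (rule sum.swap)
    finally show "(\<Sum>p<d * r. ?q ^ p * (\<Sum>i=1..s. c i * word_block m r k (w i) p)) = 0"
      using sol by simp
    fix p assume p: "p < d * r"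
    have "\<bar>\<Sum>i=1..s. c i * word_block m r k (w i) p\<bar> \<le> (\<Sum>i=1..s. \<bar>c i * word_block m r k (w i) p\<bar>)"
      by (rule sum_abs)
    also have "\<dots> \<le> (\<Sum>i=1..s. \<bar>c i\<bar> * (int m ^ k - 1))"
    proof (rule sum_mono)
      fix i assume i: "i \<in> {1..s}"
      show "\<bar>c i * word_block m r k (w i) p\<bar> \<le> \<bar>c i\<bar> * (int m ^ k - 1)"
        unfolding abs_mult using word_block_bounds[OF m r A w[OF i] p]
        by (intro mult_left_mono) auto
    qed
    also have "\<dots> = K * (int m ^ k - 1)" by (simp add: K_def sum_distrib_right)
    also have "\<dots> < ?q" using K_ge_1 by (simp add: right_diff_distrib)
    finally show "\<bar>\<Sum>i=1..s. c i * word_block m r k (w i) p\<bar> < ?q" .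
  qed (rule that)
  have row: "?row b \<ge> 0 \<and> (?row b = 0 \<longrightarrow> (\<forall>j<k. trivial_solution ?G s c (\<lambda>i. w i (b, j))))"
    if b: "b < d" for b
  proof (rule digitwise_trivial[where R = "{1..r}" and m = "int m"
        and D = "\<lambda>j l. \<Sum>i=1..s. c i * w i (b, j) l"])
    fix l assume l: "l \<in> {1..r}"
    have "(\<Sum>j<k. int m ^ j * (\<Sum>i=1..s. c i * w i (b, j) l))
        = (\<Sum>j<k. \<Sum>i=1..s. c i * (int m ^ j * w i (b, j) l))"
      by (simp add: sum_distrib_left mult.left_commute)
    also have "\<dots> = (\<Sum>i=1..s. c i * (\<Sum>j<k. int m ^ j * w i (b, j) l))"
      unfolding sum_distrib_left by (rule sum.swap)
    finally show "(\<Sum>j<k. int m ^ j * (\<Sum>i=1..s. c i * w i (b, j) l)) = 0"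
      using block[OF block_index(1)[OF l b]] unfolding word_block_index[OF l b] by simp
  next
    fix j assume j: "j < k" and triv: "trivial_solution ?G s c (\<lambda>i. w i (b, j))"
    show "?g b j = 0 \<and> (\<forall>l\<in>{1..r}. (\<Sum>i=1..s. c i * w i (b, j) l) = 0)"
      using f_trivial[OF wA[OF b j] triv] combination_eq_0_if_trivial[OF triv] by simp
  next
    fix j assume j: "j < k" and dvd: "\<forall>l\<in>{1..r}. int m dvd (\<Sum>i=1..s. c i * w i (b, j) l)"
      and nontriv: "\<not> trivial_solution ?G s c (\<lambda>i. w i (b, j))"
    have "is_solution ?G s c (\<lambda>i. w i (b, j))"
      using m dvd wA[OF b j] A by (intro is_solution_integer_mod_power_groupI) auto
    then show "?g b j > 0"
      using f_nontrivial[OF wA[OF b j]] nontriv by (simp add: nontrivial_solution_def)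
  next
    fix j assume j: "j < k"
    have "\<bar>?g b j\<bar> \<le> B - 1"
      using sum_abs[of "\<lambda>i. f i (w i (b, j))" "{1..s}"] sum_abs_f_le[OF wA[OF b j]] by linarith
    then show "- (B - 1) \<le> ?g b j" by (simp add: abs_le_iff)
  qed (use B_ge_1 m in auto)
  \<comment> \<open>Replacing each \<open>w i\<close> by \<open>w 1\<close> does not change the
    weights, and the diagonal total is zero. Nonnegative row totals with sum zero all
    vanish.\<close>
  have "(\<Sum>b<d. ?row b) = (\<Sum>i=1..s. weight d k i (w i))"
    by (rule sum_weight[symmetric])
  also have "\<dots> = (\<Sum>i=1..s. weight d k i (w 1))"
    by (rule sum.cong[OF refl]) (rule level)
  also have "\<dots> = 0" using sum_weight_diagonal w[of 1] s by simp
  finally have "\<forall>b\<in>{..<d}. ?row b = 0"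
    using row by (subst (asm) sum_nonneg_eq_0_iff) auto
  then show ?thesis using row bj by blast
qed

lemma L_free_level_set:
  assumes W: "W \<subseteq> {..<d} \<times> {..<k} \<rightarrow>\<^sub>E A"
    and level: "\<And>v w i. v \<in> W \<Longrightarrow> w \<in> W \<Longrightarrow> i \<in> {1..s} \<Longrightarrow> weight d k i v = weight d k i w"
  shows "L_free integer_group s c ((\<lambda>w. word_value (K * int m ^ k) m r d k w + 1) ` W)"
  unfolding L_free_def
proof (intro conjI ballI impI)
  let ?E = "\<lambda>w. word_value (K * int m ^ k) m r d k w"
  fix x assume x: "x \<in> {1..s} \<rightarrow> (\<lambda>w. ?E w + 1) ` W" and sol: "is_solution integer_group s c x"
  have "\<forall>i\<in>{1..s}. \<exists>w. w \<in> W \<and> x i = ?E w + 1" using x by fast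
  then obtain w where w: "\<And>i. i \<in> {1..s} \<Longrightarrow> w i \<in> W"
    and xw: "\<And>i. i \<in> {1..s} \<Longrightarrow> x i = ?E (w i) + 1" by metis
  \<comment> \<open>The shift by one, which moves the values into \<open>{1..N}\<close>, cancels
    because the coefficients sum to zero.\<close>
  have "(\<Sum>i=1..s. c i * ?E (w i)) + (\<Sum>i=1..s. c i) = (\<Sum>i=1..s. c i * x i)"
    unfolding sum.distrib[symmetric] by (rule sum.cong) (auto simp: xw distrib_left)
  then have "(\<Sum>i=1..s. c i * ?E (w i)) = 0"
    using sol c_sum by (simp add: is_solution_integer_group)
  then have triv: "trivial_solution (integer_mod_power_group m r) s c (\<lambda>i. w i (b, j))"
    if "b < d" "j < k" for b j
    using w W level s that by (intro solution_words_trivial[where d = d and k = k]) auto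
  \<comment> \<open>On each block of the integer coefficient partition the words agree letter by
    letter, hence so do the integers \<open>x i\<close>. The equality partition of \<open>x\<close>
    is therefore a coarsening of it.\<close>
  let ?P = "coefficient_partition 0 s c"
  have P: "zero_sum_partition 0 s c ?P"
    using primitive_coefficient_partition(1)[OF prim(2)] .
  have "refines {1..s} ?P (equality_partition s x)"
  proof (rule refines_equality_partitionI)
    show part: "partition_on {1..s} ?P" using P by (simp add: zero_sum_partition_def)
    fix p i i' assume p: "p \<in> ?P" "i \<in> p" "i' \<in> p"
    then have i: "i \<in> {1..s}" "i' \<in> {1..s}" using partition_onD1[OF part] by blast+
    have "w i = w i'"
    proof (rule PiE_ext)
      show "w i \<in> {..<d} \<times> {..<k} \<rightarrow>\<^sub>E A" "w i' \<in> {..<d} \<times> {..<k} \<rightarrow>\<^sub>E A"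
        using w i W by auto
      show "w i bj = w i' bj" if "bj \<in> {..<d} \<times> {..<k}" for bj
        using that refines_equality_partitionD[OF coefficient_partition_refines_if_trivial[OF triv] p] by auto
    qed
    then show "x i = x i'" using xw i by simp
  qed
  then show "trivial_solution integer_group s c x"
    by (intro trivial_solution_integer_groupI refines_zero_sum_partition[OF P])
qed simp

text \<open>Pigeonhole on the tuple of all \<open>s\<close> weights: a largest fibre
  \<open>W\<close> is a level set, and the encoding keeps its size.\<close>

lemma ex_large_L_free_set:
  "\<exists>S \<subseteq> {1..(K * int m ^ t) ^ (t * r)}. L_free integer_group s c S \<and>
     card A ^ (t * t) \<le> card S * nat (3 * B) ^ (t * s)"
proof -
  let ?W = "{..<t} \<times> {..<t} \<rightarrow>\<^sub>E A" and ?q = "K * int m ^ t"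
  let ?V = "int t * B ^ t"
  let ?levels = "{1..s} \<rightarrow>\<^sub>E {- ?V..?V}"
  define \<Phi> where "\<Phi> w = (\<lambda>i\<in>{1..s}. weight t t i w)" for w
  have V: "?V \<ge> 0" using B_ge_1 by simp
  have \<Phi>: "\<Phi> \<in> ?W \<rightarrow> ?levels"
  proof
    fix w assume "w \<in> ?W"
    then have "\<bar>weight t t i w\<bar> \<le> ?V" if "i \<in> {1..s}" for i
      using abs_weight_le that by blast
    then have "- ?V \<le> weight t t i w \<and> weight t t i w \<le> ?V" if "i \<in> {1..s}" for i
      using that unfolding abs_le_iff by (metis minus_le_iff)
    then show "\<Phi> w \<in> ?levels" unfolding \<Phi>_def by (intro restrict_PiE_iff[THEN iffD2]) simp
  qed
  have fin: "finite ?W" "finite ?levels" using finite_A by (auto intro!: finite_PiE)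
  have ne: "?levels \<noteq> {}" using V by (simp add: PiE_eq_empty_iff)
  obtain y where y: "card ?W \<le> card (\<Phi> -` {y} \<inter> ?W) * card ?levels"
    using pigeonhole_card[OF \<Phi> fin ne] by blast
  define W where "W = \<Phi> -` {y} \<inter> ?W"
  define S where "S = (\<lambda>w. word_value ?q m r t t w + 1) ` W"
  have q: "?q \<ge> int m ^ t" using K_ge_1 by (simp add: mult_le_cancel_right1)
  have "L_free integer_group s c S"
    unfolding S_def
  proof (rule L_free_level_set)
    fix v w i assume "v \<in> W" "w \<in> W" and i: "i \<in> {1..s}"
    then have "\<Phi> v i = \<Phi> w i" by (simp add: W_def)
    then show "weight t t i v = weight t t i w" using i by (simp add: \<Phi>_def)
  qed (simp add: W_def)
  moreover have "S \<subseteq> {1..?q ^ (t * r)}"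
  proof
    fix z assume "z \<in> S"
    then obtain w where "z = word_value ?q m r t t w + 1" "w \<in> ?W"
      by (auto simp: S_def W_def)
    then show "z \<in> {1..?q ^ (t * r)}"
      using word_value_bounds[OF m r A _ q, of w t] by simp
  qed
  moreover have "card A ^ (t * t) \<le> card S * nat (3 * B) ^ (t * s)"
  proof -
    have "card S = card W"
      unfolding S_def
    proof (rule card_image)
      show "inj_on (\<lambda>w. word_value ?q m r t t w + 1) W"
        using inj_on_word_value[OF m r A q, of t] by (auto simp: inj_on_def W_def)
    qed
    moreover have "card ?W = card A ^ (t * t)"
      by (subst card_PiE) (auto simp: card_cartesian_product)
    moreover have "card ?levels \<le> nat (3 * B) ^ (t * s)"
    proof -
      \<comment> \<open>Each weight takes at most \<open>2 * t * B ^ t + 1\<close> values; absorbing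
        the factor \<open>2 * t + 1\<close> into \<open>3 ^ t\<close> bounds this by
        \<open>(3 * B) ^ t\<close>.\<close>
      have "2 * int t + 1 \<le> 3 ^ t" by (induction t) auto
      then have "2 * ?V + B ^ t \<le> 3 ^ t * B ^ t"
        using B_ge_1 mult_right_mono[of "2 * int t + 1" "3 ^ t" "B ^ t"] by (simp add: algebra_simps)
      moreover have "B ^ t \<ge> 1" using B_ge_1 by (rule one_le_power)
      ultimately have "2 * ?V + 1 \<le> (3 * B) ^ t" by (simp add: power_mult_distrib)
      then have "nat (2 * ?V + 1) \<le> nat ((3 * B) ^ t)" by (rule nat_mono)
      also have "\<dots> = nat (3 * B) ^ t" using B_ge_1 by (intro nat_power_eq) simp
      finally have "nat (2 * ?V + 1) ^ s \<le> (nat (3 * B) ^ t) ^ s" by (rule power_mono) simp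
      moreover have "card ?levels = nat (2 * ?V + 1) ^ s"
        by (subst card_PiE) (auto simp: algebra_simps)
      ultimately show ?thesis by (simp add: power_mult)
    qed
    ultimately show ?thesis
      using y le_trans[OF _ mult_le_mono2] unfolding W_def[symmetric] by simp
  qed
  ultimately show ?thesis by blast
qed

end

lemma card_le_r_L:
  assumes "S \<subseteq> {1..int N}" "L_free integer_group s c S"
  shows "card S \<le> r_L s c N"
proof -
  have "{card A | A. A \<subseteq> {1..int N} \<and> L_free integer_group s c A} \<subseteq> card ` Pow {1..int N}"
    by auto
  then have "finite {card A | A. A \<subseteq> {1..int N} \<and> L_free integer_group s c A}"
    by (rule finite_subset) simp
  then show ?thesis unfolding r_L_def using assms by (intro Max_ge) auto
qed

section \<open>The choice of the number of rows\<close>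

text \<open>Passing from \<open>t\<close> to \<open>t + 1\<close> changes both sides only by a factor \<open>exp (O(t))\<close>, and
  \<open>t\<^sup>2 \<le> 4 * ln N\<close>.\<close>

lemma level_set_lower_bound:
  fixes a m K b N R :: real and r s t :: nat
  defines "C1 \<equiv> ln a / ln m * ln K + 2 * ln a + real s * ln b"
  assumes a: "a \<ge> 1" and m: "m \<ge> 2" and K: "K \<ge> 1" and b: "b \<ge> 1" and r: "r \<ge> 1"
    and N3: "N \<ge> 3" and R: "R > 0"
    and lower: "(K * m ^ t) ^ (t * r) \<le> N"
    and upper: "N \<le> (K * m ^ Suc t) ^ (Suc t * r)"
    and card: "a ^ (t * t) \<le> R * b ^ (t * s)"
  shows "N powr (1 / real r * log m a) * exp (- (3 * C1 / sqrt (ln (ln 3))) * sqrt (ln N * ln (ln N))) \<le> R"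
proof -
  define \<alpha> where "\<alpha> = 1 / real r * log m a"
  have lm: "ln m > 0" and la: "ln a \<ge> 0" and lK: "ln K \<ge> 0" and lb: "ln b \<ge> 0"
    using a m K b by auto
  have C1: "C1 \<ge> 0" unfolding C1_def using lm la lK lb by simp
  have ln3: "ln 3 > (1::real)" by (rule ln3_gt_1)
  have lnN: "ln N \<ge> ln 3" using N3 by simp
  have lln: "0 < ln (ln 3 :: real)" using ln3 by simp
  have llN: "ln (ln 3) \<le> ln (ln N)" using lnN ln3 by simp
  have "ln ((K * m ^ t) ^ (t * r)) \<le> ln N" using lower K m N3 by (subst ln_le_cancel_iff) auto
  then have "real (t * r) * (ln K + real t * ln m) \<le> ln N"
    using K m by (simp add: ln_realpow ln_mult)
  moreover have "real t * (real t * ln m) \<le> real (t * r) * (ln K + real t * ln m)"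
    using r lK lm by (intro mult_mono) (auto simp: mult_le_cancel_left1)
  \<comment> \<open>The constant \<open>1/4\<close> makes the left side a perfect square, which
    yields \<open>t \<le> 2 * sqrt (ln N)\<close>.\<close>
  moreover have "real t * (real t * (1/4)) \<le> real t * (real t * ln m)"
  proof -
    have "ln 2 \<le> ln m" using m by simp
    then show ?thesis using ln2_ge_two_thirds by (intro mult_left_mono) auto
  qed
  ultimately have "(real t / 2)\<^sup>2 \<le> ln N" by (simp add: power2_eq_square)
  then have "real t / 2 \<le> sqrt (ln N)" by (rule real_le_rsqrt)
  moreover have "1 \<le> sqrt (ln N)" using lnN ln3 by simp
  ultimately have t: "real t + 1 \<le> 3 * sqrt (ln N)" by linarith
  have "ln N \<le> ln ((K * m ^ Suc t) ^ (Suc t * r))" using upper N3 by (subst ln_le_cancel_iff) auto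
  also have "\<dots> = real r * (real t + 1) * (ln K + (real t + 1) * ln m)"
    using K m by (simp add: ln_realpow ln_mult algebra_simps del: power_Suc)
  finally have "\<alpha> * ln N \<le> \<alpha> * (real r * (real t + 1) * (ln K + (real t + 1) * ln m))"
    using la lm by (intro mult_left_mono) (auto simp: \<alpha>_def log_def)
  also have "\<dots> = (real t + 1) * (ln a / ln m * ln K) + (real t + 1)\<^sup>2 * ln a"
    using r lm by (simp add: \<alpha>_def log_def field_simps power2_eq_square)
  finally have \<alpha>N: "\<alpha> * ln N \<le> (real t + 1) * (ln a / ln m * ln K) + (real t + 1)\<^sup>2 * ln a" .
  have "ln (a ^ (t * t)) \<le> ln (R * b ^ (t * s))" using card a R b by (subst ln_le_cancel_iff) auto
  then have lnR: "(real t)\<^sup>2 * ln a \<le> ln R + real t * (real s * ln b)"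
    using a R b by (simp add: ln_realpow ln_mult power2_eq_square mult.assoc)
  \<comment> \<open>The main terms differ only by \<open>(t + 1)^2 - t^2 = 2 * t + 1\<close> copies
    of \<open>ln a\<close>, so the loss is linear in \<open>t\<close>.\<close>
  have "\<alpha> * ln N - ln R \<le> (real t + 1) * (ln a / ln m * ln K) + (2 * real t + 1) * ln a
      + real t * (real s * ln b)"
    using \<alpha>N lnR by (simp add: power2_eq_square algebra_simps)
  also have "\<dots> \<le> (real t + 1) * (ln a / ln m * ln K) + (2 * real t + 2) * ln a
      + (real t + 1) * (real s * ln b)"
    using la lb by (intro add_mono mult_right_mono order_refl) auto
  also have "\<dots> = C1 * (real t + 1)" by (simp add: C1_def algebra_simps)
  also have "\<dots> \<le> C1 * (3 * sqrt (ln N))" using t C1 by (rule mult_left_mono)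
  \<comment> \<open>The error obtained is of order \<open>sqrt (ln N)\<close>. Since
    \<open>ln (ln N)\<close> is at least \<open>ln (ln 3) > 0\<close>, dividing by the square root
    of that constant gives the stated form for all \<open>N \<ge> 3\<close>.\<close>
  also have "\<dots> \<le> 3 * C1 / sqrt (ln (ln 3)) * sqrt (ln N * ln (ln N))"
  proof -
    have "sqrt (ln N) * sqrt (ln (ln 3)) \<le> sqrt (ln N) * sqrt (ln (ln N))"
      using llN lnN ln3 by (intro mult_left_mono) auto
    then have "sqrt (ln N) \<le> sqrt (ln N * ln (ln N)) / sqrt (ln (ln 3))"
      using lln by (simp add: real_sqrt_mult pos_le_divide_eq)
    then have "3 * C1 * sqrt (ln N) \<le> 3 * C1 * (sqrt (ln N * ln (ln N)) / sqrt (ln (ln 3)))"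
      using C1 by (intro mult_left_mono) auto
    then show ?thesis by simp
  qed
  finally have "\<alpha> * ln N - 3 * C1 / sqrt (ln (ln 3)) * sqrt (ln N * ln (ln N)) \<le> ln R" by linarith
  then have "exp (\<alpha> * ln N - 3 * C1 / sqrt (ln (ln 3)) * sqrt (ln N * ln (ln N))) \<le> exp (ln R)"
    by simp
  then show ?thesis
    using N3 R unfolding \<alpha>_def[symmetric]
    by (simp add: powr_def exp_diff exp_minus divide_inverse)
qed

theorem theorem5:
  fixes s m r :: nat and c :: "nat \<Rightarrow> int" and A :: "(nat \<Rightarrow> int) set"
  assumes "s \<ge> 3"
    and "\<forall>i\<in>{1..s}. c i \<noteq> 0"
    and "(\<Sum>i=1..s. c i) = 0"
    and "m \<ge> 2"
    and "r \<ge> 1"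
    and "primitive_form m s c"
    and "primitive_form 0 s c"
    and "coefficient_partition m s c = coefficient_partition 0 s c"
    and "L_seed (integer_mod_power_group m r) s c A"
    and "A \<noteq> {}"
  shows "\<exists>C>0. \<forall>N::nat. N \<ge> 3 \<longrightarrow>
           real (r_L s c N) \<ge>
             real N powr (1 / real r * log (real m) (real (card A))) *
             exp (- C * sqrt (ln (real N) * ln (ln (real N))))"
proof -
  obtain f where "seeded_form s m r c A f"
  proof -
    assume *: "\<And>f. seeded_form s m r c A f \<Longrightarrow> thesis"
    let ?G = "integer_mod_power_group m r"
    have A: "A \<subseteq> carrier ?G" using assms(9) by (simp add: L_seed_def)
    obtain f :: "nat \<Rightarrow> (nat \<Rightarrow> int) \<Rightarrow> int" where
      "\<forall>x \<in> {1..s} \<rightarrow> A. trivial_solution ?G s c x \<longrightarrow> (\<Sum>i=1..s. f i (x i)) = 0"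
      "\<forall>x \<in> {1..s} \<rightarrow> A. nontrivial_solution ?G s c x \<longrightarrow> (\<Sum>i=1..s. f i (x i)) > 0"
      using assms(9) unfolding L_seed_def by blast
    with assms(1-8) A show thesis by (intro *[of f]) (unfold_locales, auto)
  qed
  then interpret seeded_form s m r c A f .
  define a b where "a = real (card A)" and "b = real_of_int (3 * B)"
  define C1 where
    "C1 = ln a / ln (real m) * ln (real_of_int K) + 2 * ln a + real s * ln b"
  define C where "C = 3 * C1 / sqrt (ln (ln 3))"
  have a: "a \<ge> 1"
    using finite_A \<open>A \<noteq> {}\<close> by (simp add: a_def Suc_le_eq card_gt_0_iff)
  have b: "b \<ge> 3" using B_ge_1 by (simp add: b_def)
  \<comment> \<open>Strictness comes from the last summand: \<open>b \<ge> 3\<close> makes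
    \<open>ln b\<close> positive.\<close>
  have "C1 > 0"
    unfolding C1_def using a b s m K_ge_1 by (intro add_nonneg_pos) auto
  then have "C > 0" using ln3_gt_1 by (simp add: C_def)
  moreover have "real (r_L s c N) \<ge> real N powr (1 / real r * log (real m) a) *
      exp (- C * sqrt (ln (real N) * ln (ln (real N))))" if N: "N \<ge> 3" for N :: nat
  proof -
    let ?h = "\<lambda>t. (K * int m ^ t) ^ (t * r)"
    have "int N < ?h N"
    proof -
      have "int N < 2 ^ N" by (rule of_nat_less_two_power)
      also have "\<dots> \<le> int m ^ N" using m by (intro power_mono) auto
      also have "\<dots> \<le> K * int m ^ N" using K_ge_1 by (simp add: mult_le_cancel_right1)
      finally have N_less: "int N < K * int m ^ N" .
      also have "\<dots> \<le> ?h N"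
        by (rule self_le_power) (use N_less N r in \<open>linarith, auto\<close>)
      finally show ?thesis .
    qed
    \<comment> \<open>Since \<open>?h 0 = 1\<close> and \<open>?h N > N\<close>, there is an index
      \<open>t\<close> with \<open>?h t \<le> N < ?h (t + 1)\<close>.\<close>
    moreover have "\<not> int N < ?h 0" using N by simp
    ultimately obtain t where "\<not> int N < ?h t" and upper: "int N < ?h (Suc t)"
      using ex_least_nat_less[of "\<lambda>t. int N < ?h t" N] by auto
    then have lower: "?h t \<le> int N" by simp
    obtain S where S: "S \<subseteq> {1..?h t}" "L_free integer_group s c S"
      "card A ^ (t * t) \<le> card S * nat (3 * B) ^ (t * s)"
      using ex_large_L_free_set[of t] by blast
    have "card S \<le> r_L s c N"
      using S lower by (intro card_le_r_L) auto
    then have "card A ^ (t * t) \<le> r_L s c N * nat (3 * B) ^ (t * s)"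
      using S(3) by (meson le_trans mult_le_mono1)
    then have "real (card A ^ (t * t)) \<le> real (r_L s c N * nat (3 * B) ^ (t * s))"
      by (simp only: of_nat_le_iff)
    then have card: "a ^ (t * t) \<le> real (r_L s c N) * b ^ (t * s)"
      using B_ge_1 by (simp add: a_def b_def)
    \<comment> \<open>Positivity of \<open>r_L\<close> is required before taking its logarithm; it
      follows from \<open>A\<close> being nonempty.\<close>
    have "0 < a ^ (t * t)" using a by simp
    then have R: "0 < real (r_L s c N)" using card by (cases "r_L s c N = 0") auto
    have low: "(real_of_int K * real m ^ t) ^ (t * r) \<le> real N"
      using lower by (metis (mono_tags, lifting) of_int_le_iff of_int_mult of_int_of_nat_eq of_int_power)
    have up: "real N \<le> (real_of_int K * real m ^ Suc t) ^ (Suc t * r)"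
      using less_imp_le[OF upper]
      by (metis (mono_tags, lifting) of_int_le_iff of_int_mult of_int_of_nat_eq of_int_power)
    show ?thesis
      unfolding C_def C1_def
      by (rule level_set_lower_bound[OF _ _ _ _ _ _ R low up card])
        (use a b m r K_ge_1 N in auto)
  qed
  ultimately show ?thesis unfolding a_def by blast
qed

end
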